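(* Let $\mathbb{P}^{\tilde e}$ be a constraint-free extended multi-adjoint logic program (EMALP) on an extended multi-adjoint lattice with carrier $L$, let $\neg\colon L\to L$ be an involutive negation operator, and let $\mathbb{P}$ be the corresponding multi-adjoint normal logic program (MANLP) of $\mathbb{P}^{\tilde e}$ built with $\neg$. Let $M^{\tilde e}\colon\Pi_{\mathbb{P}^{\tilde e}}\to L$ be an interpretation, and let $M\colon\Pi_{\mathbb{P}^{\tilde e}}\cup\{\mathrm{not}_q\mid q\in\mathcal{N}_{\mathbb{P}^{\tilde e}}\}\to L$ be given by $M(p)=M^{\tilde e}(p)$ if $p\in\Pi_{\mathbb{P}^{\tilde e}}$ and $M(\mathrm{not}_q)=\hat M(\neg q)$ for all $q\in\mathcal{N}_{\mathbb{P}^{\tilde e}}$. Then $M^{\tilde e}$ is a stable model of $\mathbb{P}^{\tilde e}$ if and only if $M$ is a stable model of $\mathbb{P}$.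
   Context: Adjoint pair: given a partially ordered set $(P,\leq)$, a pair $(\&,\leftarrow)$ of binary operations on $P$ is an adjoint pair if $\&$ is order-preserving in both arguments; $\leftarrow$ is order-preserving in its first argument (the consequent) and order-reversing in its second argument (the antecedent), i.e. $z\leftarrow y$ is increasing in $z$ and decreasing in $y$; and $x\leq (z\leftarrow y)$ iff $(x\& y)\leq z$ for all $x,y,z\in P$. Multi-adjoint lattice: a tuple $(L,\preceq,\leftarrow_1,\&_1,\dots,\leftarrow_r,\&_r)$ where $(L,\preceq)$ is a bounded lattice with bottom $\bot$ and top $\top$, each $(\&_i,\leftarrow_i)$ is an adjoint pair in $(L,\preceq)$, and $\top\&_i\vartheta=\vartheta\&_i\top=\vartheta$ for all $\vartheta\in L$ and all $i$. A negation operator is an order-reversing mapping $\neg\colon L\to L$ with $\neg\bot=\top$, $\neg\top=\bot$; it is involutive if $\neg\neg x=x$ for all $x$. A multi-adjoint lattice together with a negation operator is a multi-adjoint normal lattice. Extended aggregator: a mapping $@^e\colon L^n\to L$ on a complete lattice $(L,\preceq)$ which is order-preserving in its first $m$ arguments and order-reversing in its last $n-m$ arguments; one writes $@^e[x_1,\dots,x_m;x_{m+1},\dots,x_n]$. An extended multi-adjoint lattice is a multi-adjoint lattice, with $(L,\preceq)$ complete, enriched with a finite family of extended aggregators $@^e_1,\dots,@^e_k$ (arities $n$ and numbers $m$ may depend on the aggregator). An aggregator operator is a mapping $@\colon L^n\to L$ order-preserving in all arguments (no boundary conditions required). Constraint-free EMALP: a finite set $\mathbb{P}^{\tilde e}$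 of weighted rules $\langle p\leftarrow_i @^e[p_1,\dots,p_m;p_{m+1},\dots,p_n];\vartheta\rangle$, where $i\in\{1,\dots,r\}$, $@^e$ is one of the extended aggregators of the lattice, $\vartheta\in L$, and $p,p_1,\dots,p_n$ are propositional symbols with $p_1,\dots,p_n$ pairwise distinct. MANLP: on a multi-adjoint normal lattice, a finite set $\mathbb{P}$ of weighted rules $\langle p\leftarrow_i @[p_1,\dots,p_m,\neg p_{m+1},\dots,\neg p_n];\vartheta\rangle$, with $@$ an aggregator operator, $\vartheta\in L$, and $p,p_1,\dots,p_n$ propositional symbols with $p_1,\dots,p_n$ pairwise distinct. Semantics (both kinds of programs): $\Pi_{\mathbb{Q}}$ is the set of propositional symbols of a program $\mathbb{Q}$; an interpretation is a mapping $I\colon\Pi_{\mathbb{Q}}\to L$, extended to formulas inductively as $\hat I$ (so $\hat I(\neg q)=\neg(I(q))$ and elements of $L$ evaluate to themselves). Interpretations are ordered pointwise. A rule $\langle p\leftarrow_i\mathcal{B};\vartheta\rangle$ is satisfied by $I$ iff $\vartheta\preceq I(p)\leftarrow_i\hat I(\mathcal{B})$; a model satisfies all rules; the least model is a model that is pointwise $\preceq$ every model. Reducts and stable models: for an EMALP, the reduct with respect to an interpretation $M$ replaces each rule body $@^e[p_1,\dots,p_m;p_{m+1},\dots,p_n]$ by $@^e_M[p_1,\dots,p_m]$, where $@^e_M[\vartheta_1,\dots,\vartheta_m]=@^e[\vartheta_1,\dots,\vartheta_m;M(p_{m+1}),\dots,M(p_n)]$; for a MANLP it replaces each body $@[p_1,\dots,p_m,\neg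 p_{m+1},\dots,\neg p_n]$ by $@_M[p_1,\dots,p_m]$, where $@_M[\vartheta_1,\dots,\vartheta_m]=@[\vartheta_1,\dots,\vartheta_m,\neg M(p_{m+1}),\dots,\neg M(p_n)]$. (Models of a reduct are taken among interpretations with the same domain as $M$.) $M$ is a stable model of the program if it is the least model of its reduct with respect to $M$. Corresponding MANLP: let $\mathcal{N}_{\mathbb{P}^{\tilde e}}$ be the set of propositional symbols that appear in an order-reversing argument of an extended aggregator in the body of some rule of $\mathbb{P}^{\tilde e}$. For each $q\in\mathcal{N}_{\mathbb{P}^{\tilde e}}$ let $\mathrm{not}_q\notin\Pi_{\mathbb{P}^{\tilde e}}$ be a new propositional symbol (distinct for distinct $q$). Given an involutive negation operator $\neg$ on $L$, the corresponding MANLP $\mathbb{P}$, on the multi-adjoint normal lattice $(L,\preceq,\leftarrow_1,\&_1,\dots,\leftarrow_r,\&_r,\neg)$, consists of the rules $\langle p\leftarrow_i @[p_1,\dots,p_m,\mathrm{not}_{p_{m+1}},\dots,\mathrm{not}_{p_n}];\vartheta\rangle$ for every $\langle p\leftarrow_i @^e[p_1,\dots,p_m;p_{m+1},\dots,p_n];\vartheta\rangle\in\mathbb{P}^{\tilde e}$, together with one rule $\langle\mathrm{not}_q\leftarrow_j\neg q;\top\rangle$ for every $q\in\mathcal{N}_{\mathbb{P}^{\tilde e}}$ (with $j\in\{1,\dots,r\}$), where $@$ is the aggregator operator $@[\vartheta_1,\dots,\vartheta_n]=@^e[\vartheta_1,\dots,\vartheta_m;\neg\vartheta_{m+1},\dots,\neg\vartheta_n]$.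 *)

theory Defs
  imports "HOL-Library.FuncSet"
begin

section \<open>Multi-adjoint lattices\<close>

text \<open>In \<open>imp z y\<close> the first argument is the consequent, i.e. \<open>imp z y\<close> is \<open>z \<leftarrow> y\<close>.\<close>

definition adjoint_pair :: "('a::order \<Rightarrow> 'a \<Rightarrow> 'a) \<Rightarrow> ('a \<Rightarrow> 'a \<Rightarrow> 'a) \<Rightarrow> bool" where
  "adjoint_pair cnj imp \<longleftrightarrow>
     (\<forall>y. mono (\<lambda>x. cnj x y)) \<and> (\<forall>x. mono (\<lambda>y. cnj x y)) \<and>
     (\<forall>y. mono (\<lambda>z. imp z y)) \<and> (\<forall>z. antimono (\<lambda>y. imp z y)) \<and>
     (\<forall>x y z. x \<le> imp z y \<longleftrightarrow> cnj x y \<le> z)"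

text \<open>The carrier of a lattice is the whole type \<open>'a\<close>; a record holds the operations, of which
  only those with index in \<open>{1..num_pairs}\<close> are significant.\<close>

record 'a multi_adjoint =
  num_pairs :: nat
  adj_conj :: "nat \<Rightarrow> 'a \<Rightarrow> 'a \<Rightarrow> 'a"
  adj_impl :: "nat \<Rightarrow> 'a \<Rightarrow> 'a \<Rightarrow> 'a"

definition multi_adjoint_lattice :: "('a::bounded_lattice, 'z) multi_adjoint_scheme \<Rightarrow> bool" where
  "multi_adjoint_lattice L \<longleftrightarrow>
     (\<forall>i\<in>{1..num_pairs L}. adjoint_pair (adj_conj L i) (adj_impl L i) \<and>
        (\<forall>x. adj_conj L i top x = x \<and> adj_conj L i x top = x))"

definition negation_operator :: "('a::bounded_lattice \<Rightarrow> 'a) \<Rightarrow> bool" where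
  "negation_operator neg \<longleftrightarrow> antimono neg \<and> neg bot = top \<and> neg top = bot"

definition involutive :: "('a \<Rightarrow> 'a) \<Rightarrow> bool" where
  "involutive f \<longleftrightarrow> (\<forall>x. f (f x) = x)"

record 'a multi_adjoint_normal = "'a multi_adjoint" +
  negation :: "'a \<Rightarrow> 'a"

definition multi_adjoint_normal_lattice :: "'a::bounded_lattice multi_adjoint_normal \<Rightarrow> bool" where
  "multi_adjoint_normal_lattice L \<longleftrightarrow> multi_adjoint_lattice L \<and> negation_operator (negation L)"

text \<open>Operators of arity \<open>n\<close> act on lists; only their values on lists of length \<open>n\<close> matter.\<close>

definition aggregator :: "nat \<Rightarrow> ('a::order list \<Rightarrow> 'a) \<Rightarrow> bool" where
  "aggregator n f \<longleftrightarrow>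
     (\<forall>xs i x y. length xs = n \<and> i < n \<and> x \<le> y \<longrightarrow> f (xs[i := x]) \<le> f (xs[i := y]))"

record 'a ext_agg =
  arity :: nat
  num_pos :: nat
  app :: "'a list \<Rightarrow> 'a"

definition extended_aggregator :: "'a::complete_lattice ext_agg \<Rightarrow> bool" where
  "extended_aggregator A \<longleftrightarrow> num_pos A \<le> arity A \<and>
     (\<forall>xs i x y. length xs = arity A \<and> x \<le> y \<longrightarrow>
        (i < num_pos A \<longrightarrow> app A (xs[i := x]) \<le> app A (xs[i := y])) \<and>
        (num_pos A \<le> i \<and> i < arity A \<longrightarrow> app A (xs[i := y]) \<le> app A (xs[i := x])))"

record 'a ext_multi_adjoint = "'a multi_adjoint" +
  num_aggs :: nat
  agg :: "nat \<Rightarrow> 'a ext_agg"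

definition extended_multi_adjoint_lattice :: "'a::complete_lattice ext_multi_adjoint \<Rightarrow> bool" where
  "extended_multi_adjoint_lattice E \<longleftrightarrow> multi_adjoint_lattice E \<and>
     (\<forall>k\<in>{1..num_aggs E}. extended_aggregator (agg E k))"

definition normal_lattice_of ::
  "'a ext_multi_adjoint \<Rightarrow> ('a \<Rightarrow> 'a) \<Rightarrow> 'a multi_adjoint_normal" where
  "normal_lattice_of E neg =
     \<lparr>num_pairs = num_pairs E, adj_conj = adj_conj E, adj_impl = adj_impl E, negation = neg\<rparr>"


section \<open>Programs\<close>

text \<open>\<open>ERule p i k ps ns \<theta>\<close> is the rule \<open>\<langle>p \<leftarrow>\<^sub>i @\<^sup>e\<^sub>k[ps; ns]; \<theta>\<rangle>\<close>.\<close>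

datatype ('s, 'a) erule = ERule 's nat nat "'s list" "'s list" 'a

text \<open>\<open>NRule p i f ps ns \<theta>\<close> is the rule \<open>\<langle>p \<leftarrow>\<^sub>i f[ps, \<not>ns]; \<theta>\<rangle>\<close>.\<close>

datatype ('s, 'a) nrule = NRule 's nat "'a list \<Rightarrow> 'a" "'s list" "'s list" 'a

text \<open>\<open>PRule p i f ps \<theta>\<close> is the rule \<open>\<langle>p \<leftarrow>\<^sub>i f[ps]; \<theta>\<rangle>\<close>; reducts consist of such rules.\<close>

datatype ('s, 'a) prule = PRule 's nat "'a list \<Rightarrow> 'a" "'s list" 'a

fun erule_on :: "'a ext_multi_adjoint \<Rightarrow> ('s, 'a) erule \<Rightarrow> bool" where
  "erule_on E (ERule p i k ps ns \<theta>) \<longleftrightarrow>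
     i \<in> {1..num_pairs E} \<and> k \<in> {1..num_aggs E} \<and>
     length ps = num_pos (agg E k) \<and> length (ps @ ns) = arity (agg E k) \<and> distinct (ps @ ns)"

definition emalp :: "'a ext_multi_adjoint \<Rightarrow> ('s, 'a) erule set \<Rightarrow> bool" where
  "emalp E P \<longleftrightarrow> finite P \<and> (\<forall>\<rho>\<in>P. erule_on E \<rho>)"

fun nrule_on :: "'a::bounded_lattice multi_adjoint_normal \<Rightarrow> ('s, 'a) nrule \<Rightarrow> bool" where
  "nrule_on L (NRule p i f ps ns \<theta>) \<longleftrightarrow>
     i \<in> {1..num_pairs L} \<and> aggregator (length (ps @ ns)) f \<and> distinct (ps @ ns)"

definition manlp :: "'a::bounded_lattice multi_adjoint_normal \<Rightarrow> ('s, 'a) nrule set \<Rightarrow> bool" where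
  "manlp L P \<longleftrightarrow> finite P \<and> (\<forall>\<rho>\<in>P. nrule_on L \<rho>)"

fun erule_symbols :: "('s, 'a) erule \<Rightarrow> 's set" where
  "erule_symbols (ERule p i k ps ns \<theta>) = {p} \<union> set ps \<union> set ns"

definition esymbols :: "('s, 'a) erule set \<Rightarrow> 's set" where
  "esymbols P = (\<Union>\<rho>\<in>P. erule_symbols \<rho>)"

fun nrule_symbols :: "('s, 'a) nrule \<Rightarrow> 's set" where
  "nrule_symbols (NRule p i f ps ns \<theta>) = {p} \<union> set ps \<union> set ns"

definition nsymbols :: "('s, 'a) nrule set \<Rightarrow> 's set" where
  "nsymbols P = (\<Union>\<rho>\<in>P. nrule_symbols \<rho>)"


section \<open>Semantics\<close>

text \<open>A mapping from \<open>D\<close> to the lattice is a function that is \<open>undefined\<close> outside \<open>D\<close>.\<close>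

definition interpretations :: "'s set \<Rightarrow> ('s \<Rightarrow> 'a) set" where
  "interpretations D = D \<rightarrow>\<^sub>E UNIV"

fun satisfies :: "('a::order, 'z) multi_adjoint_scheme \<Rightarrow> ('s \<Rightarrow> 'a) \<Rightarrow> ('s, 'a) prule \<Rightarrow> bool" where
  "satisfies L I (PRule p i f ps \<theta>) \<longleftrightarrow> \<theta> \<le> adj_impl L i (I p) (f (map I ps))"

definition model_on ::
  "('a::order, 'z) multi_adjoint_scheme \<Rightarrow> 's set \<Rightarrow> ('s, 'a) prule set \<Rightarrow> ('s \<Rightarrow> 'a) \<Rightarrow> bool" where
  "model_on L D P I \<longleftrightarrow> I \<in> interpretations D \<and> (\<forall>\<rho>\<in>P. satisfies L I \<rho>)"

definition least_model_on ::
  "('a::order, 'z) multi_adjoint_scheme \<Rightarrow> 's set \<Rightarrow> ('s, 'a) prule set \<Rightarrow> ('s \<Rightarrow> 'a) \<Rightarrow> bool" where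
  "least_model_on L D P M \<longleftrightarrow>
     model_on L D P M \<and> (\<forall>I. model_on L D P I \<longrightarrow> (\<forall>p\<in>D. M p \<le> I p))"

fun erule_reduct :: "'a ext_multi_adjoint \<Rightarrow> ('s \<Rightarrow> 'a) \<Rightarrow> ('s, 'a) erule \<Rightarrow> ('s, 'a) prule" where
  "erule_reduct E M (ERule p i k ps ns \<theta>) =
     PRule p i (\<lambda>xs. app (agg E k) (xs @ map M ns)) ps \<theta>"

fun nrule_reduct :: "'a multi_adjoint_normal \<Rightarrow> ('s \<Rightarrow> 'a) \<Rightarrow> ('s, 'a) nrule \<Rightarrow> ('s, 'a) prule" where
  "nrule_reduct L M (NRule p i f ps ns \<theta>) =
     PRule p i (\<lambda>xs. f (xs @ map (\<lambda>q. negation L (M q)) ns)) ps \<theta>"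

text \<open>The models of a reduct range over the interpretations of the symbols of the original
  program, some of which may no longer occur in the reduct.\<close>

definition emalp_stable_model ::
  "'a::complete_lattice ext_multi_adjoint \<Rightarrow> ('s, 'a) erule set \<Rightarrow> ('s \<Rightarrow> 'a) \<Rightarrow> bool" where
  "emalp_stable_model E P M \<longleftrightarrow> least_model_on E (esymbols P) (erule_reduct E M ` P) M"

definition manlp_stable_model ::
  "'a::bounded_lattice multi_adjoint_normal \<Rightarrow> ('s, 'a) nrule set \<Rightarrow> ('s \<Rightarrow> 'a) \<Rightarrow> bool" where
  "manlp_stable_model L P M \<longleftrightarrow> least_model_on L (nsymbols P) (nrule_reduct L M ` P) M"


section \<open>The corresponding MANLP\<close>

fun erule_neg_symbols :: "('s, 'a) erule \<Rightarrow> 's set" where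
  "erule_neg_symbols (ERule p i k ps ns \<theta>) = set ns"

definition neg_symbols :: "('s, 'a) erule set \<Rightarrow> 's set" where
  "neg_symbols P = (\<Union>\<rho>\<in>P. erule_neg_symbols \<rho>)"

definition fresh_symbols :: "('s, 'a) erule set \<Rightarrow> ('s \<Rightarrow> 's) \<Rightarrow> bool" where
  "fresh_symbols P nt \<longleftrightarrow>
     inj_on nt (neg_symbols P) \<and> (\<forall>q\<in>neg_symbols P. nt q \<notin> esymbols P)"

definition negate_tail :: "('a \<Rightarrow> 'a) \<Rightarrow> 'a ext_agg \<Rightarrow> 'a list \<Rightarrow> 'a" where
  "negate_tail neg A xs = app A (take (num_pos A) xs @ map neg (drop (num_pos A) xs))"

fun translate_rule ::
  "'a ext_multi_adjoint \<Rightarrow> ('a \<Rightarrow> 'a) \<Rightarrow> ('s \<Rightarrow> 's) \<Rightarrow> ('s, 'a) erule \<Rightarrow> ('s, 'a) nrule" where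
  "translate_rule E neg nt (ERule p i k ps ns \<theta>) =
     NRule p i (negate_tail neg (agg E k)) (ps @ map nt ns) [] \<theta>"

text \<open>\<open>hd\<close> serves as the identity aggregator of arity 1. The implication used in the rule for
  \<open>nt q\<close> is the one with index \<open>j q\<close>.\<close>

definition corresponding_manlp ::
  "'a::bounded_lattice ext_multi_adjoint \<Rightarrow> ('a \<Rightarrow> 'a) \<Rightarrow> ('s \<Rightarrow> 's) \<Rightarrow> ('s \<Rightarrow> nat) \<Rightarrow>
   ('s, 'a) erule set \<Rightarrow> ('s, 'a) nrule set" where
  "corresponding_manlp E neg nt j P =
     translate_rule E neg nt ` P \<union> (\<lambda>q. NRule (nt q) (j q) hd [] [q] top) ` neg_symbols P"

lemma multi_adjoint_normal_lattice_of:
  assumes "extended_multi_adjoint_lattice E" "negation_operator neg"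
  shows "multi_adjoint_normal_lattice (normal_lattice_of E neg)"
  using assms
  by (simp add: extended_multi_adjoint_lattice_def multi_adjoint_normal_lattice_def
      multi_adjoint_lattice_def normal_lattice_of_def)

lemma aggregator_negate_tail:
  fixes A :: "'a::complete_lattice ext_agg"
  assumes A: "extended_aggregator A" and neg: "negation_operator neg"
  shows "aggregator (arity A) (negate_tail neg A)"
  unfolding aggregator_def
proof (intro allI impI, elim conjE)
  fix xs :: "'a list" and i and x y :: 'a
  assume xs: "length xs = arity A" and i: "i < arity A" and xy: "x \<le> y"
  let ?zs = "take (num_pos A) xs @ map neg (drop (num_pos A) xs)"
  have len: "length ?zs = arity A" using xs by simp
  show "negate_tail neg A (xs[i := x]) \<le> negate_tail neg A (xs[i := y])"
  proof (cases "i < num_pos A")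
    case True
    have *: "negate_tail neg A (xs[i := v]) = app A (?zs[i := v])" for v
      using True xs i by (simp add: negate_tail_def take_update_swap list_update_append)
    show ?thesis using A len xy True unfolding * extended_aggregator_def by blast
  next
    case False
    have *: "negate_tail neg A (xs[i := v]) = app A (?zs[i := neg v])" for v
      using False xs i A
      by (simp add: negate_tail_def drop_update_swap list_update_append map_update
          extended_aggregator_def min_absorb2)
    have "neg y \<le> neg x" using neg xy by (auto simp: negation_operator_def antimono_def)
    then show ?thesis using A len False i unfolding * extended_aggregator_def
      by (meson not_less)
  qed
qed

lemma manlp_corresponding_manlp:
  fixes E :: "'a::complete_lattice ext_multi_adjoint" and P :: "('s, 'a) erule set"
  assumes E: "extended_multi_adjoint_lattice E" and P: "emalp E P"
    and neg: "negation_operator neg" and nt: "fresh_symbols P nt"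
    and j: "\<forall>q\<in>neg_symbols P. j q \<in> {1..num_pairs E}"
  shows "manlp (normal_lattice_of E neg) (corresponding_manlp E neg nt j P)"
proof -
  have fin: "finite (neg_symbols P)"
  proof -
    have "finite (erule_neg_symbols \<rho>)" for \<rho> :: "('s, 'a) erule" by (cases \<rho>) simp
    then show ?thesis using P by (simp add: neg_symbols_def emalp_def)
  qed
  have "nrule_on (normal_lattice_of E neg) (translate_rule E neg nt \<rho>)" if \<rho>: "\<rho> \<in> P" for \<rho>
  proof (cases \<rho>)
    case (ERule p i k ps ns \<theta>)
    have on: "erule_on E \<rho>" using P \<rho> by (simp add: emalp_def)
    have sub: "set ns \<subseteq> neg_symbols P" "set ps \<subseteq> esymbols P"
      using \<rho> ERule by (force simp: neg_symbols_def esymbols_def)+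
    have "distinct (ps @ map nt ns)"
      using on ERule nt sub by (auto simp: fresh_symbols_def distinct_map intro: inj_on_subset)
    moreover have "aggregator (length (ps @ map nt ns)) (negate_tail neg (agg E k))"
    proof -
      have "length (ps @ map nt ns) = arity (agg E k)" using on ERule by simp
      moreover have "extended_aggregator (agg E k)"
        using on ERule E by (simp add: extended_multi_adjoint_lattice_def)
      ultimately show ?thesis using aggregator_negate_tail[OF _ neg] by simp
    qed
    ultimately show ?thesis using on ERule by (simp add: normal_lattice_of_def)
  qed
  moreover have "aggregator (Suc 0) (hd :: 'a list \<Rightarrow> 'a)"
    by (auto simp: aggregator_def length_Suc_conv)
  ultimately show ?thesis
    using P fin j
    by (auto simp: manlp_def corresponding_manlp_def emalp_def normal_lattice_of_def)
qed

lemma nsymbols_corresponding_manlp: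
  "nsymbols (corresponding_manlp E neg nt j P) = esymbols P \<union> nt ` neg_symbols P"
proof -
  have "nrule_symbols (translate_rule E neg nt \<rho>) \<union> erule_neg_symbols \<rho> =
      erule_symbols \<rho> \<union> nt ` erule_neg_symbols \<rho>" for \<rho>
    by (cases \<rho>) auto
  then have "(\<Union>\<rho>\<in>P. nrule_symbols (translate_rule E neg nt \<rho>)) \<union> neg_symbols P =
      esymbols P \<union> nt ` neg_symbols P"
    unfolding neg_symbols_def esymbols_def by (simp add: UN_Un_distrib[symmetric] image_UN)
  then show ?thesis by (auto simp: nsymbols_def corresponding_manlp_def)
qed

end

theory Submission
  imports Defs
begin

text \<open>The rule for \<open>not\<^sub>q\<close> of the reduct of the corresponding MANLP says exactly
  \<open>I(not\<^sub>q) \<ge> \<not> M(q) = M(not\<^sub>q)\<close>. A model \<open>I\<close> of that reduct can therefore be lowered on the new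
  symbols to agree with \<open>M\<close> there; this weakens the bodies of the translated rules, which are monotone,
  and turns them into the bodies of the reduct of the EMALP. So the restriction of \<open>I\<close> is a model of
  the latter reduct, and conversely each of its models extends by \<open>M\<close> on the new symbols.\<close>

text \<open>\<open>aggregator\<close> only compares lists that differ in one position. The entries
  of \<open>xs\<close> are therefore exchanged for those of \<open>ys\<close> from left to right;
  the induction is on the number \<open>k\<close> of exchanged entries.\<close>

lemma aggregator_le:
  assumes f: "aggregator n f" and le: "list_all2 (\<le>) xs ys" and len: "length xs = n"
  shows "f xs \<le> f ys"
proof -
  have len': "length ys = n" using le len by (simp add: list_all2_lengthD)
  have "f xs \<le> f (take k ys @ drop k xs)" if "k \<le> n" for k
    using that
  proof (induction k)
    case 0
    then show ?case by simp
  next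
    case (Suc k)
    let ?zs = "take k ys @ drop k xs"
    have "?zs = ?zs[k := xs ! k]"
      using Suc.prems len len' by (simp add: list_update_append flip: Cons_nth_drop_Suc)
    moreover have "take (Suc k) ys @ drop (Suc k) xs = ?zs[k := ys ! k]"
      using Suc.prems len len'
      by (simp add: list_update_append take_Suc_conv_app_nth flip: Cons_nth_drop_Suc)
    moreover have "f (?zs[k := xs ! k]) \<le> f (?zs[k := ys ! k])"
      using f le Suc.prems len len' by (simp add: aggregator_def list_all2_conv_all_nth)
    ultimately show ?case using Suc by (metis Suc_leD order_trans)
  qed
  from this[of n] show ?thesis using len len' by simp
qed

lemma negate_tail_append:
  "length us = num_pos A \<Longrightarrow> negate_tail neg A (us @ vs) = app A (us @ map neg vs)"
  by (simp add: negate_tail_def)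

text \<open>Adjointness moves the weight \<open>top\<close> into the conjunction with
  \<open>neg (M q)\<close>, where it is neutral.\<close>

lemma satisfies_not_rule:
  assumes "extended_multi_adjoint_lattice E" "i \<in> {1..num_pairs E}"
  shows "satisfies (normal_lattice_of E neg) I
           (nrule_reduct (normal_lattice_of E neg) M (NRule r i hd [] [q] top)) \<longleftrightarrow>
         neg (M q) \<le> I r"
proof -
  have "adjoint_pair (adj_conj E i) (adj_impl E i)" "adj_conj E i top (neg (M q)) = neg (M q)"
    using assms by (auto simp: extended_multi_adjoint_lattice_def multi_adjoint_lattice_def)
  then show ?thesis by (simp add: normal_lattice_of_def adjoint_pair_def)
qed

text \<open>The negation inside \<open>negate_tail\<close> meets the one in
  \<open>neg (M q)\<close>, and the involution restores \<open>M q\<close>, the constant that the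
  EMALP reduct inserts. A translated rule has no negated body symbols, so its reduct is the same for
  every \<open>N\<close>.\<close>

lemma satisfies_translate_rule_cong:
  assumes on: "erule_on E \<rho>" and inv: "involutive neg"
    and IJ: "\<And>p. p \<in> erule_symbols \<rho> \<Longrightarrow> I p = J p"
    and not: "\<And>q. q \<in> erule_neg_symbols \<rho> \<Longrightarrow> I (nt q) = neg (M q)"
  shows "satisfies (normal_lattice_of E neg) I
           (nrule_reduct (normal_lattice_of E neg) N (translate_rule E neg nt \<rho>)) \<longleftrightarrow>
         satisfies E J (erule_reduct E M \<rho>)"
proof (cases \<rho>)
  case (ERule p i k ps ns \<theta>)
  have "map I ps = map J ps" "I p = J p" using IJ ERule by auto
  moreover have "map neg (map I (map nt ns)) = map M ns"
    using not inv ERule by (simp add: involutive_def)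
  ultimately show ?thesis using on ERule
    by (simp add: negate_tail_append normal_lattice_of_def del: map_map map_eq_conv)
qed

text \<open>Smaller values at the new symbols make the body smaller, and the implication reverses
  the order in its antecedent. The head keeps its value because \<open>I\<close> and
  \<open>J\<close> agree on the old symbols.\<close>

lemma satisfies_translate_rule_antimono:
  fixes E :: "'a::complete_lattice ext_multi_adjoint"
  assumes E: "extended_multi_adjoint_lattice E" and on: "erule_on E \<rho>"
    and neg: "negation_operator neg"
    and eq: "\<And>p. p \<in> erule_symbols \<rho> \<Longrightarrow> I p = J p"
    and le: "\<And>q. q \<in> erule_neg_symbols \<rho> \<Longrightarrow> I (nt q) \<le> J (nt q)"
    and sat: "satisfies (normal_lattice_of E neg) J
      (nrule_reduct (normal_lattice_of E neg) N (translate_rule E neg nt \<rho>))"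
  shows "satisfies (normal_lattice_of E neg) I
      (nrule_reduct (normal_lattice_of E neg) N (translate_rule E neg nt \<rho>))"
proof (cases \<rho>)
  case (ERule p i k ps ns \<theta>)
  let ?f = "negate_tail neg (agg E k)"
  let ?body = "\<lambda>I. ?f (map I (ps @ map nt ns))"
  have "aggregator (arity (agg E k)) ?f"
    using E on ERule neg by (intro aggregator_negate_tail)
      (auto simp: extended_multi_adjoint_lattice_def)
  moreover have "list_all2 (\<le>) (map I (ps @ map nt ns)) (map J (ps @ map nt ns))"
    using eq le ERule
    by (auto simp: list.rel_map intro!: list_all2_appendI list.rel_refl_strong)
  ultimately have body: "?body I \<le> ?body J"
    using on ERule by (intro aggregator_le) auto
  have "antimono (adj_impl E i (I p))"
    using E on ERule
    by (auto simp: extended_multi_adjoint_lattice_def multi_adjoint_lattice_def adjoint_pair_def)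
  from antimonoD[OF this body] show ?thesis
    using sat eq ERule by (auto simp: normal_lattice_of_def)
qed

theorem theorem23:
  fixes E :: "'a::complete_lattice ext_multi_adjoint"
    and Pe :: "('s, 'a) erule set"
    and neg :: "'a \<Rightarrow> 'a"
    and nt :: "'s \<Rightarrow> 's"
    and j :: "'s \<Rightarrow> nat"
    and Me M :: "'s \<Rightarrow> 'a"
  assumes "extended_multi_adjoint_lattice E"
    and "emalp E Pe"
    and "negation_operator neg" and "involutive neg"
    and "fresh_symbols Pe nt"
    and "\<forall>q\<in>neg_symbols Pe. j q \<in> {1..num_pairs E}"
    and "Me \<in> interpretations (esymbols Pe)"
    and "M \<in> interpretations (esymbols Pe \<union> nt ` neg_symbols Pe)"
    and "\<forall>p\<in>esymbols Pe. M p = Me p"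
    and "\<forall>q\<in>neg_symbols Pe. M (nt q) = neg (M q)"
  shows "emalp_stable_model E Pe Me \<longleftrightarrow>
    manlp_stable_model (normal_lattice_of E neg) (corresponding_manlp E neg nt j Pe) M"
proof -
  let ?S = "esymbols Pe" and ?Q = "neg_symbols Pe" and ?N = "normal_lattice_of E neg"
  let ?D = "?S \<union> nt ` ?Q"
  let ?e_model = "model_on E ?S (erule_reduct E Me ` Pe)"
  let ?n_model = "model_on ?N ?D (nrule_reduct ?N M ` corresponding_manlp E neg nt j Pe)"
  have QS: "?Q \<subseteq> ?S"
  proof -
    have "erule_neg_symbols \<rho> \<subseteq> erule_symbols \<rho>" for \<rho> :: "('s, 'a) erule" by (cases \<rho>) auto
    then show ?thesis by (auto simp: neg_symbols_def esymbols_def)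
  qed
  \<comment> \<open>Stated with \<open>Me\<close>, since the EMALP reduct is taken with respect to
    \<open>Me\<close>.\<close>
  have not: "M (nt q) = neg (Me q)" if "q \<in> ?Q" for q using that assms(9,10) QS by auto
  have new: "nt q \<notin> ?S" if "q \<in> ?Q" for q using that assms(5) by (simp add: fresh_symbols_def)
  have e_model: "?e_model I \<longleftrightarrow> I \<in> interpretations ?S \<and>
      (\<forall>\<rho>\<in>Pe. satisfies E I (erule_reduct E Me \<rho>))" for I
    by (simp add: model_on_def)
  have n_model: "?n_model I \<longleftrightarrow> I \<in> interpretations ?D \<and>
      (\<forall>\<rho>\<in>Pe. satisfies ?N I (nrule_reduct ?N M (translate_rule E neg nt \<rho>))) \<and>
      (\<forall>q\<in>?Q. M (nt q) \<le> I (nt q))" for I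
    unfolding model_on_def corresponding_manlp_def image_Un ball_Un ball_simps
    using assms(6,10)
    by (simp add: satisfies_not_rule[OF assms(1)] del: satisfies.simps nrule_reduct.simps
        cong: conj_cong)
  have transfer: "(\<forall>\<rho>\<in>Pe. satisfies ?N I (nrule_reduct ?N M (translate_rule E neg nt \<rho>))) \<longleftrightarrow>
      (\<forall>\<rho>\<in>Pe. satisfies E J (erule_reduct E Me \<rho>))"
    if "\<And>p. p \<in> ?S \<Longrightarrow> I p = J p" "\<And>q. q \<in> ?Q \<Longrightarrow> I (nt q) = M (nt q)" for I J
    using that assms(2,4) not
    by (intro ball_cong refl satisfies_translate_rule_cong)
      (auto simp: emalp_def esymbols_def neg_symbols_def)
  \<comment> \<open>At \<open>M\<close> itself the inequalities for the new symbols hold by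
    reflexivity.\<close>
  have M_model: "?n_model M \<longleftrightarrow> ?e_model Me"
    using transfer[of M Me] assms(7-9) by (simp add: n_model e_model)
  have restrict: "?e_model (restrict I ?S)" if I: "?n_model I" for I
  proof -
    let ?I' = "\<lambda>p. if p \<in> ?S then I p else M p"
    have "satisfies ?N ?I' (nrule_reduct ?N M (translate_rule E neg nt \<rho>))" if \<rho>: "\<rho> \<in> Pe" for \<rho>
    proof (rule satisfies_translate_rule_antimono[OF assms(1) _ assms(3)])
      show "erule_on E \<rho>" using \<rho> assms(2) by (simp add: emalp_def)
      show "?I' p = I p" if "p \<in> erule_symbols \<rho>" for p
        using that \<rho> by (auto simp: esymbols_def)
      show "?I' (nt q) \<le> I (nt q)" if "q \<in> erule_neg_symbols \<rho>" for q
      proof -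
        have "q \<in> ?Q" using that \<rho> by (auto simp: neg_symbols_def)
        then show ?thesis using I by (simp add: n_model)
      qed
      show "satisfies ?N I (nrule_reduct ?N M (translate_rule E neg nt \<rho>))"
        using \<rho> I by (simp add: n_model)
    qed
    \<comment> \<open>By freshness no \<open>nt q\<close> lies in \<open>?S\<close>, so
      \<open>?I'\<close> takes the value of \<open>M\<close> there, as \<open>transfer\<close>
      demands.\<close>
    then show ?thesis
      using transfer[of ?I' "restrict I ?S"] new by (simp add: e_model interpretations_def)
  qed
  have extend: "?n_model (\<lambda>p. if p \<in> ?S then I p else M p)" if I: "?e_model I" for I
  proof -
    let ?I' = "\<lambda>p. if p \<in> ?S then I p else M p"
    \<comment> \<open>Outside \<open>?D\<close> the value falls back to that of \<open>M\<close>,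
      which is \<open>undefined\<close> there.\<close>
    have "?I' \<in> interpretations ?D"
      using assms(8) by (auto simp: interpretations_def PiE_def extensional_def)
    then show ?thesis
      using transfer[of ?I' I] I new by (simp add: n_model e_model)
  qed
  \<comment> \<open>Only minimality remains. On the new symbols \<open>M p \<le> I p\<close> is
    already part of \<open>n_model\<close>, so the two conditions differ only by passing between
    \<open>I\<close> and its restriction or extension, neither of which changes values on
    \<open>?S\<close>.\<close>
  have "(\<forall>I. ?e_model I \<longrightarrow> (\<forall>p\<in>?S. Me p \<le> I p)) \<longleftrightarrow>
      (\<forall>I. ?n_model I \<longrightarrow> (\<forall>p\<in>?D. M p \<le> I p))"
  proof (intro iffI allI impI ballI)
    fix I p
    assume least: "\<forall>I. ?e_model I \<longrightarrow> (\<forall>p\<in>?S. Me p \<le> I p)" and I: "?n_model I" and p: "p \<in> ?D"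
    have "M p \<le> I p" if "p \<in> ?S"
      using least restrict[OF I] that assms(9) by fastforce
    moreover have "M p \<le> I p" if "p \<in> nt ` ?Q"
      using I that by (auto simp: n_model)
    ultimately show "M p \<le> I p" using p by blast
  next
    fix I p
    assume least: "\<forall>I. ?n_model I \<longrightarrow> (\<forall>p\<in>?D. M p \<le> I p)" and I: "?e_model I" and p: "p \<in> ?S"
    from least extend[OF I] p have "M p \<le> (if p \<in> ?S then I p else M p)" by blast
    then show "Me p \<le> I p" using p assms(9) by simp
  qed
  with M_model show ?thesis
    by (simp add: emalp_stable_model_def manlp_stable_model_def least_model_on_def
        nsymbols_corresponding_manlp)
qed

end
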